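(* Let $U$ be a graph that is universal for the class of locally finite graphs with path-width $1$. Then $U$ has path-width $\infty$.
   Context: All graphs (including universal graphs) are simple and countable (the vertex set is finite or countably infinite). A graph $U$ contains a graph $G$ if a subgraph (not necessarily induced) of $U$ is isomorphic to $G$. A graph $U$ is universal for a graph class $\mathcal{G}$ if $U$ contains every graph in $\mathcal{G}$ ($U$ need not be in $\mathcal{G}$). A graph is locally finite if every vertex has finite degree. A path-decomposition of a graph $G$ is a sequence $(B_t:t\in\mathbb{N})$ of subsets of $V(G)$ (bags) such that: $\bigcup_{t}B_t=V(G)$; for each edge $vw\in E(G)$ there is $t\in\mathbb{N}$ with $v,w\in B_t$; and $B_{t_1}\cap B_{t_3}\subseteq B_{t_2}$ whenever $t_1\leq t_2\leq t_3$. Its width is $\sup_{t\in\mathbb{N}}(|B_t|-1)$. The path-width of $G$ is the minimum width of a path-decomposition of $G$ (it is $\infty$ if every path-decomposition has bags of unbounded size). *)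

theory Defs
  imports "HOL-Library.Extended_Real" "HOL-Library.Countable_Set"
begin

record 'a ugraph =
  verts :: "'a set"
  edges :: "'a set set"

definition countable_graph :: "'a ugraph \<Rightarrow> bool" where
  "countable_graph G \<longleftrightarrow>
     countable (verts G) \<and> (\<forall>e\<in>edges G. e \<subseteq> verts G \<and> card e = 2)"

definition subgraph_of :: "'a ugraph \<Rightarrow> 'a ugraph \<Rightarrow> bool" where
  "subgraph_of H G \<longleftrightarrow>
     countable_graph H \<and> verts H \<subseteq> verts G \<and> edges H \<subseteq> edges G"

definition isomorphic_graphs :: "'a ugraph \<Rightarrow> 'b ugraph \<Rightarrow> bool" where
  "isomorphic_graphs G H \<longleftrightarrow>
     (\<exists>f. bij_betw f (verts G) (verts H) \<and>
        (\<forall>v\<in>verts G. \<forall>w\<in>verts G. {v, w} \<in> edges G \<longleftrightarrow> {f v, f w} \<in> edges H))"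

definition contains_graph :: "'a ugraph \<Rightarrow> 'b ugraph \<Rightarrow> bool" where
  "contains_graph U G \<longleftrightarrow> (\<exists>H. subgraph_of H U \<and> isomorphic_graphs H G)"

(* A class of graphs is a set of graphs on a common vertex type. With nat as that type no
   countable graph is lost up to isomorphism: see countable_graph_iso_nat below. *)

definition universal_for :: "'a ugraph \<Rightarrow> 'b ugraph set \<Rightarrow> bool" where
  "universal_for U C \<longleftrightarrow> (\<forall>G\<in>C. contains_graph U G)"

definition neighbours :: "'a ugraph \<Rightarrow> 'a \<Rightarrow> 'a set" where
  "neighbours G v = {w \<in> verts G. {v, w} \<in> edges G}"

definition locally_finite :: "'a ugraph \<Rightarrow> bool" where
  "locally_finite G \<longleftrightarrow> (\<forall>v\<in>verts G. finite (neighbours G v))"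

definition path_decomposition :: "'a ugraph \<Rightarrow> (nat \<Rightarrow> 'a set) \<Rightarrow> bool" where
  "path_decomposition G B \<longleftrightarrow>
     (\<Union>t. B t) = verts G \<and>
     (\<forall>v w. {v, w} \<in> edges G \<longrightarrow> (\<exists>t. v \<in> B t \<and> w \<in> B t)) \<and>
     (\<forall>t1 t2 t3. t1 \<le> t2 \<and> t2 \<le> t3 \<longrightarrow> B t1 \<inter> B t3 \<subseteq> B t2)"

(* Bags may be infinite, and card is 0 on infinite sets. Widths live in ereal because an
   empty bag contributes -1. *)

definition ecard :: "'a set \<Rightarrow> ereal" where
  "ecard A = (if finite A then ereal (real (card A)) else \<infinity>)"

definition decomposition_width :: "(nat \<Rightarrow> 'a set) \<Rightarrow> ereal" where
  "decomposition_width B = (SUP t. ecard (B t) - 1)"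

(* The infimum is a minimum: see path_width_attained below. *)

definition path_width :: "'a ugraph \<Rightarrow> ereal" where
  "path_width G = (INF B \<in> {B. path_decomposition G B}. decomposition_width B)"

lemma countable_graph_iso_nat:
  fixes G :: "'a ugraph"
  assumes "countable_graph G"
  shows "\<exists>H :: nat ugraph. countable_graph H \<and> isomorphic_graphs G H"
proof -
  define f where "f = to_nat_on (verts G)"
  have inj: "inj_on f (verts G)"
    using assms by (simp add: f_def countable_graph_def inj_on_to_nat_on)
  define H :: "nat ugraph"
    where "H = \<lparr>verts = f ` verts G, edges = (\<lambda>e. f ` e) ` edges G\<rparr>"
  have sub: "e \<subseteq> verts G" "card e = 2" if "e \<in> edges G" for e
    using that assms by (auto simp: countable_graph_def)
  have "card (f ` e) = 2" if "e \<in> edges G" for e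
    using sub[OF that] inj by (simp add: card_image inj_on_subset)
  then have "countable_graph H"
    using sub(1) by (auto simp: countable_graph_def H_def)
  moreover have "{v, w} \<in> edges G \<longleftrightarrow> {f v, f w} \<in> edges H"
    if "v \<in> verts G" "w \<in> verts G" for v w
  proof
    assume "{v, w} \<in> edges G"
    then have "f ` {v, w} \<in> edges H"
      unfolding H_def ugraph.select_convs by (rule imageI)
    then show "{f v, f w} \<in> edges H" by simp
  next
    assume "{f v, f w} \<in> edges H"
    then obtain e where e: "e \<in> edges G" "f ` {v, w} = f ` e" by (auto simp: H_def)
    have "{v, w} = e"
      using inj_on_image_eq_iff[OF inj, of "{v, w}" e] that sub(1)[OF e(1)] e(2) by simp
    then show "{v, w} \<in> edges G" using e(1) by simp
  qed
  moreover have "bij_betw f (verts G) (verts H)"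
    using inj by (simp add: bij_betw_def H_def)
  ultimately show ?thesis unfolding isomorphic_graphs_def by blast
qed

lemma path_decomposition_trivial:
  assumes "countable_graph G"
  shows "path_decomposition G (\<lambda>_. verts G)"
  using assms by (auto simp: path_decomposition_def countable_graph_def)

lemma decomposition_width_cases:
  "decomposition_width B = \<infinity> \<or> (\<exists>n::nat. decomposition_width B = ereal (real n) - 1)"
proof (cases "\<exists>m. \<forall>t. finite (B t) \<and> card (B t) \<le> m")
  case True
  then obtain m where m: "\<And>t. finite (B t)" "\<And>t. card (B t) \<le> m" by blast
  define S where "S = range (\<lambda>t. card (B t))"
  have S: "finite S" "S \<noteq> {}"
    unfolding S_def using m(2) by (auto intro!: finite_subset[of _ "{..m}"])
  obtain s where s: "card (B s) = Max S"
    using Max_in[OF S] unfolding S_def by auto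
  have "card (B t) \<le> card (B s)" for t
    unfolding s using S(1) by (simp add: S_def)
  then have "decomposition_width B = ecard (B s) - 1"
    unfolding decomposition_width_def
    by (intro antisym SUP_least SUP_upper ereal_minus_mono) (auto simp: ecard_def m(1))
  then show ?thesis using m(1) by (auto simp: ecard_def)
next
  case False
  have "\<exists>t\<in>UNIV. ereal (real m) \<le> ecard (B t) - 1" for m :: nat
  proof -
    obtain t where "\<not> (finite (B t) \<and> card (B t) \<le> Suc m)" using False by blast
    then have "ereal (real m) \<le> ecard (B t) - 1"
      by (auto simp: ecard_def one_ereal_def)
    then show ?thesis by blast
  qed
  then have "decomposition_width B = \<infinity>"
    unfolding decomposition_width_def by (intro SUP_PInfty)
  then show ?thesis ..
qed

lemma path_width_attained:
  assumes "countable_graph G"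
  shows "\<exists>B. path_decomposition G B \<and> decomposition_width B = path_width G"
proof (cases "\<exists>n B. path_decomposition G B \<and> decomposition_width B = ereal (real n) - 1")
  case True
  define n where
    "n = (LEAST n. \<exists>B. path_decomposition G B \<and> decomposition_width B = ereal (real n) - 1)"
  obtain B where B: "path_decomposition G B" "decomposition_width B = ereal (real n) - 1"
    using LeastI_ex[OF True] unfolding n_def by blast
  have "decomposition_width B \<le> decomposition_width B'" if B': "path_decomposition G B'" for B'
    using decomposition_width_cases[of B']
  proof
    assume "\<exists>k::nat. decomposition_width B' = ereal (real k) - 1"
    then obtain k :: nat where k: "decomposition_width B' = ereal (real k) - 1" by blast
    have "n \<le> k" unfolding n_def by (rule Least_le) (use B' k in blast)
    then show ?thesis using B(2) k by (simp add: one_ereal_def)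
  qed simp
  then have "path_width G = decomposition_width B"
    unfolding path_width_def using B(1) by (intro antisym INF_greatest INF_lower) auto
  then show ?thesis using B(1) by metis
next
  case False
  then have "decomposition_width B = \<infinity>" if "path_decomposition G B" for B
    using that decomposition_width_cases[of B] by blast
  then have "path_width G = \<infinity>"
    unfolding path_width_def by (simp add: INF_eqI)
  then show ?thesis
    using path_decomposition_trivial[OF assms] \<open>\<And>B. path_decomposition G B \<Longrightarrow> decomposition_width B = \<infinity>\<close>
    by metis
qed

end

(* Suppose U has a path-decomposition with bags of bounded size. Vertices lying in infinitely
   many bags pairwise share late bags, so there are finitely many of them, and every other vertex
   has finite degree. Hence U has only finitely many vertices of infinite degree. A caterpillar
   (a ray with leaves attached) is locally finite of path-width 1, and an embedded caterpillar
   has a tail of its ray avoiding the vertices of infinite degree. Diagonalising over the possible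
   start vertices of this tail, the number of leaves at the n-th vertex of the ray can be chosen
   so large that no vertex of U reached at that point has enough neighbours. *)

theory Submission
  imports Defs
begin

section \<open>Caterpillars\<close>

text \<open>The ray is \<open>spine d 0, spine d 1, \<dots>\<close>; the numbers strictly between \<open>spine d n\<close> and
  \<open>spine d (Suc n)\<close> are the \<open>d n\<close> leaves at \<open>spine d n\<close>.\<close>

definition spine :: "(nat \<Rightarrow> nat) \<Rightarrow> nat \<Rightarrow> nat" where
  "spine d n = (\<Sum>i<n. Suc (d i))"

definition caterpillar :: "(nat \<Rightarrow> nat) \<Rightarrow> nat ugraph" where
  "caterpillar d = \<lparr>verts = UNIV,
     edges = {{spine d n, v} |n v. spine d n < v \<and> v \<le> spine d (Suc n)}\<rparr>"

lemma spine_0 [simp]: "spine d 0 = 0"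
  by (simp add: spine_def)

lemma spine_Suc: "spine d (Suc n) = spine d n + Suc (d n)"
  by (simp add: spine_def)

lemma strict_mono_spine: "strict_mono (spine d)"
  by (simp add: strict_mono_Suc_iff spine_Suc)

lemma caterpillar_edge_iff:
  "{v, w} \<in> edges (caterpillar d) \<longleftrightarrow>
     (\<exists>n. v = spine d n \<and> v < w \<and> w \<le> spine d (Suc n) \<or>
          w = spine d n \<and> w < v \<and> v \<le> spine d (Suc n))"
  by (auto simp: caterpillar_def doubleton_eq_iff)

lemma countable_graph_caterpillar: "countable_graph (caterpillar d)"
  by (auto simp: countable_graph_def caterpillar_def)

text \<open>Smaller neighbours of \<open>v\<close> are bounded by \<open>v\<close> itself. Larger
  ones exist only when \<open>v = spine d n\<close>, and then \<open>n \<le> v\<close> because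
  \<open>spine d\<close> is strictly increasing; hence a bound in terms of \<open>v\<close>
  alone.\<close>

lemma locally_finite_caterpillar: "locally_finite (caterpillar d)"
  unfolding locally_finite_def
proof
  fix v
  have "w \<le> spine d (Suc v)" if "w \<in> neighbours (caterpillar d) v" for w
  proof -
    have "{v, w} \<in> edges (caterpillar d)"
      using that by (simp add: neighbours_def)
    then consider n where "v = spine d n" "w \<le> spine d (Suc n)" | "w < v"
      unfolding caterpillar_edge_iff by blast
    then show ?thesis
    proof cases
      case 1
      then have "n \<le> v"
        using strict_mono_imp_increasing[OF strict_mono_spine] by simp
      then have "spine d (Suc n) \<le> spine d (Suc v)"
        by (simp add: strict_mono_less_eq[OF strict_mono_spine])
      with 1 show ?thesis by simp
    next
      case 2
      moreover have "Suc v \<le> spine d (Suc v)"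
        by (rule strict_mono_imp_increasing[OF strict_mono_spine])
      ultimately show ?thesis by simp
    qed
  qed
  then have "neighbours (caterpillar d) v \<subseteq> {..spine d (Suc v)}"
    by blast
  then show "finite (neighbours (caterpillar d) v)"
    by (rule finite_subset) simp
qed

text \<open>Each \<open>w > 0\<close> has exactly one smaller neighbour, the
  \<open>spine d n\<close> with \<open>spine d n < w \<le> spine d (Suc n)\<close>. Bag
  \<open>t\<close> consists of \<open>w = Suc t\<close> and this neighbour, so the bags are the
  edges in order of their larger end.\<close>

definition caterpillar_bag :: "(nat \<Rightarrow> nat) \<Rightarrow> nat \<Rightarrow> nat set" where
  "caterpillar_bag d t = insert (Suc t) {spine d n |n. spine d n \<le> t \<and> t < spine d (Suc n)}"

lemma spine_interval_unique:
  assumes "spine d m \<le> t" "t < spine d (Suc m)" "spine d n \<le> t" "t < spine d (Suc n)"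
  shows "m = n"
proof -
  have "spine d m < spine d (Suc n)" "spine d n < spine d (Suc m)"
    using assms by linarith+
  then show ?thesis
    by (simp add: strict_mono_less[OF strict_mono_spine])
qed

lemma caterpillar_bag_subset: "\<exists>p. caterpillar_bag d t \<subseteq> {Suc t, p}"
proof (cases "\<exists>n. spine d n \<le> t \<and> t < spine d (Suc n)")
  case True
  then obtain n where n: "spine d n \<le> t" "t < spine d (Suc n)" by blast
  then have "caterpillar_bag d t \<subseteq> {Suc t, spine d n}"
    unfolding caterpillar_bag_def using spine_interval_unique by blast
  then show ?thesis ..
next
  case False
  then show ?thesis by (auto simp: caterpillar_bag_def)
qed

lemma path_decomposition_caterpillar:
  "path_decomposition (caterpillar d) (caterpillar_bag d)"
  unfolding path_decomposition_def
proof (intro conjI allI impI subsetI)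
  have "\<exists>t. v \<in> caterpillar_bag d t" for v
  proof (cases v)
    case 0
    \<comment> \<open>The vertex \<open>0\<close> is no successor; it enters bag \<open>0\<close> as
      a spine vertex.\<close>
    then have "v = spine d 0 \<and> spine d 0 \<le> 0 \<and> 0 < spine d (Suc 0)"
      by (simp add: spine_Suc)
    then have "v \<in> caterpillar_bag d 0"
      unfolding caterpillar_bag_def by blast
    then show ?thesis ..
  next
    case (Suc t)
    then show ?thesis by (auto simp: caterpillar_bag_def)
  qed
  then show "(\<Union>t. caterpillar_bag d t) = verts (caterpillar d)"
    by (auto simp: caterpillar_def)
next
  have *: "spine d n \<in> caterpillar_bag d (w - 1) \<and> w \<in> caterpillar_bag d (w - 1)"
    if "spine d n < w" "w \<le> spine d (Suc n)" for n w
  proof -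
    have "spine d n \<le> w - 1" "w - 1 < spine d (Suc n)" "w = Suc (w - 1)"
      using that by linarith+
    then show ?thesis unfolding caterpillar_bag_def by blast
  qed
  fix v w assume "{v, w} \<in> edges (caterpillar d)"
  then show "\<exists>t. v \<in> caterpillar_bag d t \<and> w \<in> caterpillar_bag d t"
    unfolding caterpillar_edge_iff using * by blast
next
  fix t1 t2 t3 v
  assume t: "t1 \<le> t2 \<and> t2 \<le> t3"
    and v: "v \<in> caterpillar_bag d t1 \<inter> caterpillar_bag d t3"
  show "v \<in> caterpillar_bag d t2"
  proof (cases "v = Suc t2")
    case False
    \<comment> \<open>Elements of bag \<open>t1\<close> are at most \<open>Suc t1\<close>, so
      \<open>Suc t3\<close> can lie in it only if \<open>t1 = t3\<close>. Thus a common
      \<open>v\<close> other than \<open>Suc t2\<close> is the spine vertex of bag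
      \<open>t3\<close>, and the interval that starts at \<open>v\<close> also contains
      \<open>t2\<close>.\<close>
    have "v \<noteq> Suc t3 \<or> t2 = t3"
    proof (rule ccontr)
      assume "\<not> ?thesis"
      then have "v = Suc t3" "t1 < t3" using t by auto
      then show False using v by (auto simp: caterpillar_bag_def)
    qed
    then have "v \<noteq> Suc t3" using False by auto
    then obtain n where n: "v = spine d n" "v \<le> t3" "t3 < spine d (Suc n)"
      using v by (auto simp: caterpillar_bag_def)
    have "v \<le> Suc t1" using v by (auto simp: caterpillar_bag_def)
    then have "v \<le> t2" "t2 < spine d (Suc n)" using t n False by auto
    then show ?thesis using n(1) by (auto simp: caterpillar_bag_def)
  qed (simp add: caterpillar_bag_def)
qed

lemma decomposition_width_ge_1:
  assumes "path_decomposition G B" "{v, w} \<in> edges G" "v \<noteq> w"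
  shows "1 \<le> decomposition_width B"
proof -
  obtain t where t: "{v, w} \<subseteq> B t"
    using assms unfolding path_decomposition_def by blast
  have "ereal 2 \<le> ecard (B t)"
  proof (cases "finite (B t)")
    case True
    then have "card {v, w} \<le> card (B t)" using t by (rule card_mono)
    then show ?thesis using True assms(3) by (simp add: ecard_def)
  qed (simp add: ecard_def)
  then have "1 \<le> ecard (B t) - 1"
    by (cases "ecard (B t)") (auto simp: one_ereal_def)
  also have "\<dots> \<le> decomposition_width B"
    unfolding decomposition_width_def by (rule SUP_upper) simp
  finally show ?thesis .
qed

lemma path_width_caterpillar: "path_width (caterpillar d) = 1"
proof (rule antisym)
  have "ecard (caterpillar_bag d t) - 1 \<le> 1" for t
  proof -
    obtain p where p: "caterpillar_bag d t \<subseteq> {Suc t, p}"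
      using caterpillar_bag_subset by blast
    then have "card (caterpillar_bag d t) \<le> card {Suc t, p}"
      by (intro card_mono) auto
    also have "\<dots> \<le> 2" by (simp add: card_insert_if)
    finally show ?thesis
      using finite_subset[OF p] by (simp add: ecard_def one_ereal_def)
  qed
  then have "decomposition_width (caterpillar_bag d) \<le> 1"
    unfolding decomposition_width_def by (intro SUP_least)
  then show "path_width (caterpillar d) \<le> 1"
    unfolding path_width_def using path_decomposition_caterpillar
    by (intro INF_lower2) auto
  \<comment> \<open>The first edge of the ray is present for every \<open>d\<close>, even without
    leaves.\<close>
  have "{spine d 0, spine d (Suc 0)} \<in> edges (caterpillar d)"
    unfolding caterpillar_edge_iff by (intro exI[of _ 0]) (simp add: spine_Suc)
  then show "1 \<le> path_width (caterpillar d)"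
    unfolding path_width_def
    by (intro INF_greatest) (auto intro!: decomposition_width_ge_1 simp: spine_Suc)
qed

section \<open>Vertices of infinite degree\<close>

lemma finite_width_bags_bounded:
  assumes "decomposition_width B \<noteq> \<infinity>"
  obtains k where "\<And>t. finite (B t)" "\<And>t. card (B t) \<le> k"
proof -
  obtain k :: nat where k: "decomposition_width B = ereal (real k) - 1"
    using decomposition_width_cases[of B] assms by blast
  have "finite (B t) \<and> card (B t) \<le> k" for t
  proof -
    have "ecard (B t) - 1 \<le> ereal (real k) - 1"
      unfolding k[symmetric] decomposition_width_def by (rule SUP_upper) simp
    then show ?thesis
      by (auto simp: ecard_def one_ereal_def split: if_splits)
  qed
  then show ?thesis using that by blast
qed

lemma finite_infinite_degree_vertices:
  assumes pd: "path_decomposition G B"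
    and fin: "\<And>t. finite (B t)" and bound: "\<And>t. card (B t) \<le> k"
  shows "finite {v. infinite (neighbours G v)}"
proof -
  define X where "X = {v. infinite {t. v \<in> B t}}"
  have persist: "\<exists>s. \<forall>t\<ge>s. v \<in> B t" if "v \<in> X" for v
  proof -
    have inf: "infinite {t. v \<in> B t}" using that by (simp add: X_def)
    then obtain s where s: "v \<in> B s"
      using infinite_imp_nonempty by blast
    \<comment> \<open>Bag \<open>t\<close> lies between bag \<open>s\<close> and some later bag
      containing \<open>v\<close>.\<close>
    have "v \<in> B t" if "s \<le> t" for t
    proof -
      obtain u where "t \<le> u" "v \<in> B u"
        using inf unfolding infinite_nat_iff_unbounded_le by blast
      then show ?thesis
        using pd s \<open>s \<le> t\<close> unfolding path_decomposition_def by blast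
    qed
    then show ?thesis by blast
  qed
  have "card F \<le> k" if F: "F \<subseteq> X" "finite F" for F
  proof -
    obtain s where s: "\<And>v t. v \<in> F \<Longrightarrow> s v \<le> t \<Longrightarrow> v \<in> B t"
      using persist F(1) by (metis subsetD)
    \<comment> \<open>The sum dominates every \<open>s v\<close>, so one bag contains all of
      \<open>F\<close>.\<close>
    have "F \<subseteq> B (\<Sum>v\<in>F. s v)"
      using s member_le_sum[OF _ _ F(2), of _ s] by auto
    then show ?thesis
      using card_mono[OF fin] bound order_trans by blast
  qed
  then have "finite X"
    by (rule finite_if_finite_subsets_card_bdd[THEN conjunct1])
  \<comment> \<open>Each neighbour shares a bag with \<open>v\<close>, and only finitely many bags,
    all finite, contain \<open>v\<close>.\<close>
  moreover have "finite (neighbours G v)" if "v \<notin> X" for v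
  proof (rule finite_subset)
    show "neighbours G v \<subseteq> (\<Union>t\<in>{t. v \<in> B t}. B t)"
      using pd by (auto simp: neighbours_def path_decomposition_def)
    show "finite (\<Union>t\<in>{t. v \<in> B t}. B t)"
      using that fin by (auto simp: X_def)
  qed
  ultimately show ?thesis
    by (auto intro: finite_subset[of _ X])
qed

section \<open>Embeddings of caterpillars and diagonalisation\<close>

lemma contains_graph_embedding:
  assumes "contains_graph U G"
  obtains f where "inj_on f (verts G)" "f ` verts G \<subseteq> verts U"
    "\<And>v w. v \<in> verts G \<Longrightarrow> w \<in> verts G \<Longrightarrow> {v, w} \<in> edges G \<Longrightarrow> {f v, f w} \<in> edges U"
proof -
  obtain H f where H: "subgraph_of H U" and f: "bij_betw f (verts H) (verts G)"
    and e: "\<And>v w. v \<in> verts H \<Longrightarrow> w \<in> verts H \<Longrightarrow>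
      {v, w} \<in> edges H \<longleftrightarrow> {f v, f w} \<in> edges G"
    using assms unfolding contains_graph_def isomorphic_graphs_def by blast
  \<comment> \<open>The given isomorphism maps the subgraph to \<open>G\<close>; the embedding is
    its inverse.\<close>
  define g where "g = inv_into (verts H) f"
  have g: "bij_betw g (verts G) (verts H)"
    unfolding g_def using f by (rule bij_betw_inv_into)
  have fg: "f (g v) = v" if "v \<in> verts G" for v
    unfolding g_def using f that by (rule bij_betw_inv_into_right)
  show ?thesis
  proof (rule that)
    show "inj_on g (verts G)" using g by (rule bij_betw_imp_inj_on)
    show "g ` verts G \<subseteq> verts U"
      using g H by (auto simp: bij_betw_def subgraph_of_def)
    show "{g v, g w} \<in> edges U"
      if vw: "v \<in> verts G" "w \<in> verts G" "{v, w} \<in> edges G" for v w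
    proof -
      have "g v \<in> verts H" "g w \<in> verts H" using g vw by (auto simp: bij_betw_def)
      then have "{g v, g w} \<in> edges H" using e fg vw by simp
      then show ?thesis using H by (auto simp: subgraph_of_def)
    qed
  qed
qed

text \<open>An embedding involves two unknowns: an index \<open>m\<close> from which the ray avoids
  the vertices of infinite degree, and the position \<open>i\<close> of its \<open>m\<close>-th
  vertex in an enumeration of \<open>U\<close>. The value \<open>d n\<close> defeats all pairs with
  \<open>m, i \<le> n\<close> at once, so each embedding fails at
  \<open>n = max m i\<close>.\<close>

lemma caterpillar_not_contained:
  fixes U :: "'a ugraph"
  assumes U: "countable_graph U" and fin: "finite {v. infinite (neighbours U v)}"
  shows "\<exists>d. \<not> contains_graph U (caterpillar d)"
proof -
  define X where "X = {v. infinite (neighbours U v)}"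
  \<comment> \<open>Discarding \<open>X\<close> keeps finite sets finite under iteration of
    \<open>N\<close>.\<close>
  define N where "N = (\<lambda>A. \<Union>v\<in>A - X. neighbours U v)"
  define u where "u = from_nat_into (verts U)"
  \<comment> \<open>The \<open>n - m\<close> steps lead from the \<open>m\<close>-th ray vertex to
    the \<open>n\<close>-th; the extra \<open>Suc\<close> collects the neighbours of the
    latter.\<close>
  define C where "C = (\<lambda>n. \<Union>m\<in>{..n}. \<Union>i\<in>{..n}. (N ^^ Suc (n - m)) {u i})"
  \<comment> \<open>The \<open>d n\<close> leaves and the next ray vertex are one more than
    \<open>C n\<close> can hold.\<close>
  define d where "d = (\<lambda>n. card (C n))"
  have "finite ((N ^^ j) {v})" for j v
    by (induction j) (auto simp: N_def X_def)
  then have finC: "finite (C n)" for n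
    unfolding C_def by blast
  have False if cont: "contains_graph U (caterpillar d)"
  proof -
    obtain f where inj: "inj f" and fV: "\<And>v. f v \<in> verts U"
      and fE: "\<And>v w. {v, w} \<in> edges (caterpillar d) \<Longrightarrow> {f v, f w} \<in> edges U"
      by (rule contains_graph_embedding[OF cont]) (auto simp: caterpillar_def)
    define x where "x = (\<lambda>n. f (spine d n))"
    have nbr: "f v \<in> neighbours U (x n)" if "spine d n < v" "v \<le> spine d (Suc n)" for n v
    proof -
      have "{spine d n, v} \<in> edges (caterpillar d)"
        using that unfolding caterpillar_edge_iff by blast
      then show ?thesis using fE fV by (simp add: neighbours_def x_def)
    qed
    have "inj x"
      unfolding x_def using inj strict_mono_imp_inj_on[OF strict_mono_spine]
      by (auto intro!: injI dest: injD)
    \<comment> \<open>By injectivity the ray meets each of the finitely many vertices in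
      \<open>X\<close> at most once.\<close>
    then have "finite (x -` X)"
      using fin by (intro finite_vimageI) (simp_all add: X_def)
    then obtain m where m: "\<And>n. m \<le> n \<Longrightarrow> x n \<notin> X"
      unfolding finite_nat_set_iff_bounded by (meson leD vimageI)
    have "x m \<in> verts U" by (simp add: x_def fV)
    then obtain i where i: "u i = x m"
      unfolding u_def using U from_nat_into_surj unfolding countable_graph_def by metis
    have reach: "x (m + j) \<in> (N ^^ j) {u i}" for j
    proof (induction j)
      case (Suc j)
      have "x (m + Suc j) \<in> neighbours U (x (m + j))"
        using nbr[of "m + j" "spine d (Suc (m + j))"] by (simp add: x_def spine_Suc)
      then show ?case using Suc m[of "m + j"] by (auto simp: N_def)
    qed (simp add: i)
    define n where "n = max m i"
    have n: "m \<le> n" "i \<le> n" by (simp_all add: n_def)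
    then have "x n \<in> (N ^^ (n - m)) {u i}" using reach[of "n - m"] by simp
    then have "neighbours U (x n) \<subseteq> (N ^^ Suc (n - m)) {u i}"
      using m[OF n(1)] by (auto simp: N_def)
    also have "\<dots> \<subseteq> C n" unfolding C_def using n by blast
    finally have "f ` {spine d n<..spine d (Suc n)} \<subseteq> C n"
      using nbr by force
    then have "card (f ` {spine d n<..spine d (Suc n)}) \<le> d n"
      unfolding d_def using finC by (intro card_mono)
    moreover have "card (f ` {spine d n<..spine d (Suc n)}) = Suc (d n)"
      using inj by (subst card_image) (auto simp: spine_Suc intro: inj_on_subset)
    ultimately show False by simp
  qed
  then show ?thesis by blast
qed

theorem theorem4:
  fixes U :: "'a ugraph"
  assumes "countable_graph U"
    and "universal_for U {G :: nat ugraph. countable_graph G \<and> locally_finite G \<and> path_width G = 1}"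
  shows "path_width U = \<infinity>"
proof (rule ccontr)
  assume "path_width U \<noteq> \<infinity>"
  then obtain B where B: "path_decomposition U B" "decomposition_width B \<noteq> \<infinity>"
    using path_width_attained[OF assms(1)] by metis
  obtain k where "\<And>t. finite (B t)" "\<And>t. card (B t) \<le> k"
    using finite_width_bags_bounded[OF B(2)] by blast
  then have "finite {v. infinite (neighbours U v)}"
    by (rule finite_infinite_degree_vertices[OF B(1)])
  then obtain d where "\<not> contains_graph U (caterpillar d)"
    using caterpillar_not_contained[OF assms(1)] by blast
  then show False
    using assms(2) countable_graph_caterpillar locally_finite_caterpillar path_width_caterpillar
    unfolding universal_for_def by blast
qed

end
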